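(* Let $\mathbf{V}$ be a variety of groups. Then every group $G\in\mathbf{V}$ is equationally Noetherian (that is, $\mathcal{L}_g(G)$-equationally Noetherian) if and only if $\mathbf{V}$ is abelian, i.e. every group in $\mathbf{V}$ is abelian.
   Context: $\mathcal{L}_g=\{\cdot,{}^{-1},1\}$ is the language of groups, and for a group $G$, $\mathcal{L}_g(G)$ is $\mathcal{L}_g$ extended by a constant symbol for every element of $G$ (interpreted as that element). An $\mathcal{L}_g(G)$-equation is an equality $p(X)=q(X)$ of two terms of $\mathcal{L}_g(G)$. A system of equations is an arbitrary (possibly infinite) set of equations in a finite set of variables $X=\{x_1,\dots,x_n\}$; its solution set in $G$ is a subset of $G^n$, and two systems are equivalent over $G$ if they have the same solution set in $G$. The group $G$ is called equationally Noetherian if every infinite system $\mathbf{S}$ of $\mathcal{L}_g(G)$-equations (in finitely many variables) is equivalent over $G$ to some finite subsystem $\mathbf{S}'\subseteq\mathbf{S}$. A variety of groups is a class of groups consisting of all groups satisfying some given set of identities in the language $\mathcal{L}_g$. *)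

theory Defs
  imports "HOL-Algebra.Group" "HOL-Library.FuncSet"
begin

text \<open>
  Terms in the language of groups with constants from \<open>'c\<close> and variables from \<open>'v\<close>;
  terms of \<open>L\<^sub>g\<close> itself are those with \<open>term_consts t = {}\<close>, and terms of \<open>L\<^sub>g(G)\<close> are those
  with \<open>term_consts t \<subseteq> carrier G\<close>.
\<close>

datatype (term_consts: 'c, term_vars: 'v) grp_term =
    Var 'v
  | Const 'c
  | One
  | Inv "('c, 'v) grp_term"
  | Mult "('c, 'v) grp_term" "('c, 'v) grp_term"

primrec eval_term :: "('a, 'b) monoid_scheme \<Rightarrow> ('v \<Rightarrow> 'a) \<Rightarrow> ('a, 'v) grp_term \<Rightarrow> 'a" where
  "eval_term G \<sigma> (Var x) = \<sigma> x"
| "eval_term G \<sigma> (Const c) = c"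
| "eval_term G \<sigma> One = \<one>\<^bsub>G\<^esub>"
| "eval_term G \<sigma> (Inv t) = inv\<^bsub>G\<^esub> (eval_term G \<sigma> t)"
| "eval_term G \<sigma> (Mult s t) = eval_term G \<sigma> s \<otimes>\<^bsub>G\<^esub> eval_term G \<sigma> t"

type_synonym ('c, 'v) grp_eqn = "('c, 'v) grp_term \<times> ('c, 'v) grp_term"

text \<open>The variables \<open>x\<^sub>1, \<dots>, x\<^sub>n\<close> are indexed by \<open>{..<n}\<close>, and \<open>G\<^sup>n\<close> is \<open>{..<n} \<rightarrow>\<^sub>E carrier G\<close>.\<close>

definition eqn_system :: "('a, 'b) monoid_scheme \<Rightarrow> nat \<Rightarrow> ('a, nat) grp_eqn set \<Rightarrow> bool" where
  "eqn_system G n S \<longleftrightarrow>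
     (\<forall>(p, q) \<in> S. term_consts p \<union> term_consts q \<subseteq> carrier G \<and>
                   term_vars p \<union> term_vars q \<subseteq> {..<n})"

definition solution_set ::
  "('a, 'b) monoid_scheme \<Rightarrow> nat \<Rightarrow> ('a, nat) grp_eqn set \<Rightarrow> (nat \<Rightarrow> 'a) set" where
  "solution_set G n S =
     {\<sigma> \<in> {..<n} \<rightarrow>\<^sub>E carrier G. \<forall>(p, q) \<in> S. eval_term G \<sigma> p = eval_term G \<sigma> q}"

definition equationally_noetherian :: "('a, 'b) monoid_scheme \<Rightarrow> bool" where
  "equationally_noetherian G \<longleftrightarrow>
     (\<forall>n S. eqn_system G n S \<and> infinite S \<longrightarrow>
        (\<exists>S' \<subseteq> S. finite S' \<and> solution_set G n S' = solution_set G n S))"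

definition satisfies_identity :: "('a, 'b) monoid_scheme \<Rightarrow> ('a, nat) grp_eqn \<Rightarrow> bool" where
  "satisfies_identity G e \<longleftrightarrow>
     (\<forall>\<sigma> \<in> UNIV \<rightarrow> carrier G. eval_term G \<sigma> (fst e) = eval_term G \<sigma> (snd e))"

text \<open>
  A class of groups is represented by its members whose carrier is a subset of the type \<open>'a\<close>,
  which plays the role of the universe. An infinite universe contains an isomorphic copy of every
  countable group; over a finite one every group would be equationally Noetherian for lack of
  infinite groups.
\<close>

definition group_variety :: "'a monoid set \<Rightarrow> bool" where
  "group_variety V \<longleftrightarrow>
     (\<exists>I :: ('a, nat) grp_eqn set.
        (\<forall>(p, q) \<in> I. term_consts p = {} \<and> term_consts q = {}) \<and>
        V = {G. group G \<and> (\<forall>e \<in> I. satisfies_identity G e)})"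

end

theory Submission
  imports
    Defs
    "HOL-Algebra.Product_Groups"
    "HOL-Algebra.Weak_Morphisms"
    "HOL-Library.Countable_Set"
    "HOL-Library.Function_Algebras"
    HOL.Modules
begin

text \<open>
  Suppose that \<open>V\<close> contains a non-abelian group \<open>H\<close>, with \<open>a\<close> and \<open>b\<close> not commuting. In the power
  \<open>H\<^sup>\<nat>\<close>, let \<open>\<alpha> i\<close> and \<open>\<beta> i\<close> be the sequences with the single nontrivial entry \<open>a\<close>, respectively \<open>b\<close>,
  in place \<open>i\<close>. Then \<open>\<beta> k\<close> commutes with every \<open>\<alpha> i\<close> except \<open>\<alpha> k\<close>, so in the system of all equations
  \<open>x \<alpha>\<^sub>i = \<alpha>\<^sub>i x\<close> every finite subsystem has a solution \<open>\<beta> k\<close> that violates another equation. Hence no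
  group that contains the \<open>\<alpha> i\<close> and \<open>\<beta> i\<close> is equationally Noetherian
  (\<open>not_equationally_noetherian_if_dual_commutation\<close>). The power itself may be too large for the
  universe \<open>'a\<close>, but the subgroup generated by these elements is countable and so has a copy there
  (\<open>exists_subdirect_power_with_dual_commutation\<close>); this copy satisfies every identity of \<open>H\<close>, because
  its coordinate homomorphisms to \<open>H\<close> separate points (\<open>satisfies_identity_subdirect_power\<close>), and thus
  belongs to \<open>V\<close>.

  Conversely, over an abelian group an equation in \<open>n\<close> variables says that a monomial
  \<open>x\<^sub>1\<^bsup>v\<^sub>1\<^esup> \<cdots> x\<^sub>n\<^bsup>v\<^sub>n\<^esup>\<close> with exponent vector \<open>v \<in> \<int>\<^sup>n\<close> has a prescribed value. Since \<open>\<int>\<^sup>n\<close> is a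
  Noetherian module, finitely many equations of the system have exponent vectors that span those of
  all the others (\<open>finite_subset_spanning\<close>). Two solutions of these finitely many equations give equal
  values to all monomials in the span, and hence satisfy the same equations of the system. So
  either these finitely many equations imply all the others, or adding a single further
  equation makes them inconsistent (\<open>abelian_imp_equationally_noetherian\<close>).
\<close>

section \<open>Evaluation of terms and homomorphisms\<close>

lemma (in group) eval_term_closed:
  assumes "term_consts t \<subseteq> carrier G" "\<And>x. x \<in> term_vars t \<Longrightarrow> \<sigma> x \<in> carrier G"
  shows "eval_term G \<sigma> t \<in> carrier G"
  using assms by (induction t) auto

lemma eval_term_hom:
  assumes "group G" "group H" "h \<in> hom G H"
    and "term_consts t = {}" "\<And>x. \<sigma> x \<in> carrier G"
  shows "h (eval_term G \<sigma> t) = eval_term H (h \<circ> \<sigma>) t"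
proof -
  interpret G: group G by fact
  interpret h: group_hom G H h
    using assms by (simp add: group_hom_def group_hom_axioms_def)
  show ?thesis
    using assms(4)
    by (induction t) (auto simp: G.eval_term_closed assms(5))
qed

text \<open>
  Varieties are closed under powers and subgroups; both are covered at once by a family of
  homomorphisms that separates points. This form keeps \<open>G\<close> and \<open>H\<close> in the same universe, which a
  statement about the power itself, whose elements are functions, would not.
\<close>

lemma satisfies_identity_subdirect_power:
  fixes G :: "('a, 'b) monoid_scheme" and H :: "('a, 'c) monoid_scheme"
  assumes "group G" "group H" "\<And>i. h i \<in> hom G H"
    and separating: "\<And>x y. x \<in> carrier G \<Longrightarrow> y \<in> carrier G \<Longrightarrow> (\<And>i. h i x = h i y) \<Longrightarrow> x = y"
    and "term_consts (fst e) = {}" "term_consts (snd e) = {}"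
    and "satisfies_identity H e"
  shows "satisfies_identity G e"
  unfolding satisfies_identity_def
proof
  fix \<sigma> :: "nat \<Rightarrow> 'a" assume "\<sigma> \<in> UNIV \<rightarrow> carrier G"
  then have \<sigma>: "\<sigma> x \<in> carrier G" for x by auto
  interpret G: group G by fact
  show "eval_term G \<sigma> (fst e) = eval_term G \<sigma> (snd e)"
  proof (rule separating)
    fix i
    have "h i \<circ> \<sigma> \<in> UNIV \<rightarrow> carrier H"
      using \<sigma> hom_in_carrier[OF assms(3)[of i]] by auto
    then show "h i (eval_term G \<sigma> (fst e)) = h i (eval_term G \<sigma> (snd e))"
      using assms \<sigma> by (simp add: eval_term_hom satisfies_identity_def)
  qed (use assms \<sigma> in \<open>auto intro!: G.eval_term_closed\<close>)
qed

section \<open>Groups with an independent family of centralizers\<close>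

text \<open>
  The centralizers of the finite subsets of \<open>{\<alpha> i | i}\<close> do not stabilize: for \<open>k \<notin> J\<close>, the element
  \<open>\<beta> k\<close> centralizes all \<open>\<alpha> i\<close> with \<open>i \<in> J\<close>, but not \<open>\<alpha> k\<close>. Centralizers of constants are solution
  sets of equations in one variable.
\<close>

lemma not_equationally_noetherian_if_dual_commutation:
  fixes \<alpha> \<beta> :: "nat \<Rightarrow> 'a"
  assumes "\<And>i. \<alpha> i \<in> carrier G" "\<And>i. \<beta> i \<in> carrier G"
    and comm: "\<And>i j. \<alpha> i \<otimes>\<^bsub>G\<^esub> \<beta> j = \<beta> j \<otimes>\<^bsub>G\<^esub> \<alpha> i \<longleftrightarrow> i \<noteq> j"
  shows "\<not> equationally_noetherian G"
proof
  assume noeth: "equationally_noetherian G"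
  define eqn :: "nat \<Rightarrow> ('a, nat) grp_eqn" where
    "eqn i = (Mult (Var 0) (Const (\<alpha> i)), Mult (Const (\<alpha> i)) (Var 0))" for i
  have "inj \<alpha>"
    by (rule injI) (metis comm)
  then have "inj eqn"
    by (auto simp: inj_def eqn_def)
  then have "infinite (range eqn)"
    using finite_imageD by blast
  moreover have "eqn_system G 1 (range eqn)"
    using assms(1) by (auto simp: eqn_system_def eqn_def)
  ultimately obtain S' where S': "S' \<subseteq> range eqn" "finite S'"
    "solution_set G 1 S' = solution_set G 1 (range eqn)"
    using noeth unfolding equationally_noetherian_def by blast
  obtain J where J: "finite J" "S' = eqn ` J"
    using finite_subset_image[OF S'(2,1)] by blast
  obtain k where k: "k \<notin> J"
    using ex_new_if_finite[OF infinite_UNIV_nat J(1)] by blast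
  have solves: "(\<lambda>i\<in>{..<1}. \<beta> k) \<in> solution_set G 1 (eqn ` I) \<longleftrightarrow> k \<notin> I" for I
  proof -
    have "(\<lambda>i\<in>{..<1}. \<beta> k) \<in> solution_set G 1 (eqn ` I) \<longleftrightarrow>
        (\<forall>i \<in> I. \<beta> k \<otimes>\<^bsub>G\<^esub> \<alpha> i = \<alpha> i \<otimes>\<^bsub>G\<^esub> \<beta> k)"
      using assms(2) by (simp add: solution_set_def eqn_def)
    also have "\<dots> \<longleftrightarrow> k \<notin> I"
      using comm[of _ k] by metis
    finally show ?thesis .
  qed
  have "(\<lambda>i\<in>{..<1}. \<beta> k) \<in> solution_set G 1 (range eqn)"
    using solves[of J] k S'(3) J(2) by simp
  then show False
    using solves[of UNIV] by simp
qed

text \<open>Every element of the generated subgroup is the value of a word in the generators and their inverses.\<close>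

lemma (in group) countable_generate:
  assumes "countable S" "S \<subseteq> carrier G"
  shows "countable (generate G S)"
proof -
  define T where "T = S \<union> m_inv G ` S"
  define val where "val xs = foldr (\<otimes>) xs \<one>" for xs
  have T: "T \<subseteq> carrier G" "countable T"
    using assms by (auto simp: T_def)
  have val_closed: "val xs \<in> carrier G" if "xs \<in> lists T" for xs
    using that T(1) by (induction xs) (auto simp: val_def)
  have val_append: "val (xs @ ys) = val xs \<otimes> val ys" if "xs \<in> lists T" "ys \<in> lists T" for xs ys
    using that(1)
  proof (induction xs)
    case Nil
    then show ?case using val_closed[OF that(2)] by (simp add: val_def)
  next
    case (Cons x xs)
    then show ?case
      using val_closed[of xs] val_closed[OF that(2)] T(1) by (auto simp: val_def m_assoc subset_iff)
  qed
  have "x \<in> val ` lists T" if "x \<in> generate G S" for x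
    using that
  proof induction
    case one
    show ?case by (rule image_eqI[of _ _ "[]"]) (auto simp: val_def)
  next
    case (incl h)
    then show ?case
      using assms(2) by (intro image_eqI[of _ _ "[h]"]) (auto simp: val_def T_def)
  next
    case (inv h)
    then have "inv h \<in> T" "inv h \<in> carrier G"
      using assms(2) by (auto simp: T_def)
    then show ?case
      by (intro image_eqI[of _ _ "[inv h]"]) (auto simp: val_def)
  next
    case (eng h1 h2)
    then obtain xs ys where "xs \<in> lists T" "ys \<in> lists T" "h1 = val xs" "h2 = val ys"
      by blast
    then show ?case
      by (intro image_eqI[of _ _ "xs @ ys"]) (auto simp: val_append)
  qed
  then have "generate G S \<subseteq> val ` lists T" by blast
  then show ?thesis
    using T(2) countable_subset countable_image countable_lists by metis
qed

lemma countable_group_copy: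
  fixes K :: "('b, 'c) monoid_scheme"
  assumes "group K" "countable (carrier K)" "infinite (UNIV :: 'a set)"
  obtains G :: "'a monoid" and g where "group G" "g \<in> iso G K"
proof -
  interpret K: group K by fact
  obtain h :: "nat \<Rightarrow> 'a" where "inj h"
    using infinite_countable_subset[OF assms(3)] by blast
  define f where "f = h \<circ> to_nat_on (carrier K)"
  have "inj_on f (carrier K)"
    unfolding f_def using assms(2) \<open>inj h\<close>
    by (intro comp_inj_on) (auto intro: inj_on_subset)
  then have "group (image_group f K)" "f \<in> iso K (image_group f K)"
    using K.inj_imp_image_group_is_group inj_imp_image_group_iso by blast+
  then show ?thesis
    using that K.iso_set_sym by blast
qed

text \<open>
  The group \<open>G\<close> is a copy of the subgroup of \<open>H\<^sup>\<nat>\<close> generated by the sequences \<open>at i a\<close> and \<open>at j b\<close> below;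
  the homomorphisms \<open>h i\<close> are the coordinates. Sequences supported in different places commute, and
  \<open>at i a\<close> and \<open>at i b\<close> do not, because \<open>a\<close> and \<open>b\<close> do not.
\<close>

lemma exists_subdirect_power_with_dual_commutation:
  fixes H :: "'a monoid"
  assumes "group H" "\<not> comm_group H" "infinite (UNIV :: 'a set)"
  obtains G :: "'a monoid" and h :: "nat \<Rightarrow> 'a \<Rightarrow> 'a" and \<alpha> \<beta> :: "nat \<Rightarrow> 'a"
  where "group G" "\<And>i. h i \<in> hom G H"
    and "\<And>x y. x \<in> carrier G \<Longrightarrow> y \<in> carrier G \<Longrightarrow> (\<And>i. h i x = h i y) \<Longrightarrow> x = y"
    and "\<And>i. \<alpha> i \<in> carrier G" "\<And>i. \<beta> i \<in> carrier G"
    and "\<And>i j. \<alpha> i \<otimes>\<^bsub>G\<^esub> \<beta> j = \<beta> j \<otimes>\<^bsub>G\<^esub> \<alpha> i \<longleftrightarrow> i \<noteq> j"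
proof -
  interpret H: group H by fact
  obtain a b where ab: "a \<in> carrier H" "b \<in> carrier H" "a \<otimes>\<^bsub>H\<^esub> b \<noteq> b \<otimes>\<^bsub>H\<^esub> a"
    using assms(2) H.group_comm_groupI by blast
  define P where "P = product_group (UNIV :: nat set) (\<lambda>_. H)"
  have carrier_P: "carrier P = UNIV \<rightarrow> carrier H"
    by (auto simp: P_def PiE_def extensional_def)
  have mult_P: "x \<otimes>\<^bsub>P\<^esub> y = (\<lambda>i. x i \<otimes>\<^bsub>H\<^esub> y i)" for x y
    by (auto simp: P_def)
  interpret P: group P
    unfolding P_def using assms(1) by simp
  define at :: "nat \<Rightarrow> 'a \<Rightarrow> nat \<Rightarrow> 'a" where
    "at i c = (\<lambda>j. if j = i then c else \<one>\<^bsub>H\<^esub>)" for i c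
  define S where "S = range (\<lambda>i. at i a) \<union> range (\<lambda>i. at i b)"
  define K where "K = P\<lparr>carrier := generate P S\<rparr>"
  have S: "S \<subseteq> carrier P" "countable S"
    using ab by (auto simp: S_def at_def carrier_P)
  have carrier_K: "carrier K = generate P S" and mult_K: "(\<otimes>\<^bsub>K\<^esub>) = (\<otimes>\<^bsub>P\<^esub>)"
    by (simp_all add: K_def)
  have K: "group K" "countable (carrier K)"
    using P.subgroup_imp_group[OF P.generate_is_subgroup[OF S(1)]]
      P.countable_generate[OF S(2,1)] by (simp_all add: K_def)
  have K_sub: "carrier K \<subseteq> carrier P"
    unfolding carrier_K using P.generate_incl[OF S(1)] .
  obtain G :: "'a monoid" and g where G: "group G" "g \<in> iso G K"
    using countable_group_copy[OF K assms(3)] .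
  interpret G: group G by fact
  have g_mult: "g (x \<otimes>\<^bsub>G\<^esub> y) = (\<lambda>i. g x i \<otimes>\<^bsub>H\<^esub> g y i)"
    if "x \<in> carrier G" "y \<in> carrier G" for x y
    using G(2) that hom_mult[of g G K x y] by (simp add: iso_def mult_K mult_P)
  have bij: "bij_betw g (carrier G) (carrier K)"
    using G(2) by (simp add: iso_def)
  have g_in: "g x i \<in> carrier H" if "x \<in> carrier G" for x i
    using bij_betwE[OF bij] that K_sub by (auto simp: carrier_P)
  define pre where "pre y = inv_into (carrier G) g y" for y
  have "at i c \<in> carrier K" if "c \<in> {a, b}" for i c
    unfolding carrier_K using that by (auto simp: S_def intro!: generate.incl)
  then have pre: "pre (at i c) \<in> carrier G" "g (pre (at i c)) = at i c" if "c \<in> {a, b}" for i c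
    using that bij unfolding pre_def bij_betw_def
    by (metis inv_into_into, metis f_inv_into_f)
  show ?thesis
  proof (rule that)
    show "group G" by fact
    show "(\<lambda>x. g x i) \<in> hom G H" for i
      by (rule homI) (simp_all add: g_in g_mult)
    show "x = y" if "x \<in> carrier G" "y \<in> carrier G" "\<And>i. g x i = g y i" for x y
      using inj_onD[OF bij_betw_imp_inj_on[OF bij], of x y] that by (simp add: fun_eq_iff)
    show "pre (at i a) \<in> carrier G" "pre (at i b) \<in> carrier G" for i
      by (simp_all add: pre)
    show "pre (at i a) \<otimes>\<^bsub>G\<^esub> pre (at j b) = pre (at j b) \<otimes>\<^bsub>G\<^esub> pre (at i a) \<longleftrightarrow> i \<noteq> j" for i j
    proof -
      have "pre (at i a) \<otimes>\<^bsub>G\<^esub> pre (at j b) = pre (at j b) \<otimes>\<^bsub>G\<^esub> pre (at i a) \<longleftrightarrow>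
          g (pre (at i a) \<otimes>\<^bsub>G\<^esub> pre (at j b)) = g (pre (at j b) \<otimes>\<^bsub>G\<^esub> pre (at i a))"
        using bij pre by (auto simp: bij_betw_def inj_on_def)
      also have "\<dots> \<longleftrightarrow> (\<forall>k. at i a k \<otimes>\<^bsub>H\<^esub> at j b k = at j b k \<otimes>\<^bsub>H\<^esub> at i a k)"
        by (simp add: g_mult pre fun_eq_iff)
      also have "\<dots> \<longleftrightarrow> i \<noteq> j"
        using ab by (auto simp: at_def)
      finally show ?thesis .
    qed
  qed
qed

section \<open>Integer vectors satisfy the ascending chain condition\<close>

text \<open>
  The module \<open>\<int>\<^sup>n\<close> is represented by the functions \<open>\<nat> \<rightarrow> \<int>\<close> that vanish from \<open>n\<close> on, so that the
  induction on \<open>n\<close> can compare \<open>\<int>\<^sup>n\<close> with \<open>\<int>\<^bsup>n+1\<^esup>\<close>.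
\<close>

interpretation int_vec: module "\<lambda>(c :: int) (v :: nat \<Rightarrow> int) i. c * v i"
  by unfold_locales (auto simp: fun_eq_iff algebra_simps)

text \<open>
  Each of the finitely many vectors in \<open>B\<close> is a finite linear combination of vectors in \<open>A\<close>. Applied to
  a finite generating set \<open>B\<close> of the span of \<open>A\<close>, this extracts a finite generating set from \<open>A\<close>.
\<close>

lemma (in module) finite_subset_of_span:
  assumes "finite B" "B \<subseteq> span A"
  shows "\<exists>F \<subseteq> A. finite F \<and> B \<subseteq> span F"
  using assms
proof (induction B)
  case empty
  then show ?case by blast
next
  case (insert b B)
  then obtain F where F: "F \<subseteq> A" "finite F" "B \<subseteq> span F" by auto
  obtain t where t: "t \<subseteq> A" "finite t" "b \<in> span t"
    using insert.prems by (auto simp: span_explicit)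
  show ?case
    using F t span_mono[of F "F \<union> t"] span_mono[of t "F \<union> t"]
    by (intro exI[of _ "F \<union> t"]) auto
qed

text \<open>
  This is the Noetherian property of \<open>\<int>\<^sup>n\<close>, in the form in which a finite subsystem is needed: the
  spanning vectors are taken from \<open>A\<close> itself. In the induction step, the submodule \<open>M\<close> spanned by \<open>A\<close> is
  generated by its part \<open>M0\<close> with vanishing last coordinate, to which the induction hypothesis
  applies, and, unless \<open>M0\<close> is all of \<open>M\<close>, one vector \<open>m\<close> whose last coordinate generates the ideal of
  all last coordinates.
\<close>

lemma finite_subset_spanning:
  assumes "\<And>v i. v \<in> A \<Longrightarrow> n \<le> i \<Longrightarrow> v i = 0"
  shows "\<exists>F \<subseteq> A. finite F \<and> A \<subseteq> int_vec.span F"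
  using assms
proof (induction n arbitrary: A)
  case 0
  then have "A \<subseteq> {0}" by (auto simp: fun_eq_iff)
  then show ?case
    using int_vec.span_zero by (intro exI[of _ "{}"]) auto
next
  case (Suc n)
  define M where "M = int_vec.span A"
  have M_sub: "int_vec.subspace M"
    by (simp add: M_def)
  have "int_vec.subspace {v. \<forall>i \<ge> Suc n. v i = 0}"
    by (rule int_vec.subspaceI) auto
  then have M_supp: "v i = 0" if "v \<in> M" "Suc n \<le> i" for v i
    using int_vec.span_minimal[of A "{v. \<forall>i \<ge> Suc n. v i = 0}"] Suc.prems that
    unfolding M_def by blast
  define M0 where "M0 = {v \<in> M. v n = 0}"
  have M0_supp: "v i = 0" if "v \<in> M0" "n \<le> i" for v i
    using that M_supp[of v i] by (cases "i = n") (auto simp: M0_def)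
  obtain F where F: "F \<subseteq> M0" "finite F" "M0 \<subseteq> int_vec.span F"
    using Suc.IH[of M0] M0_supp by blast
  have "\<exists>B \<subseteq> M. finite B \<and> M \<subseteq> int_vec.span B"
  proof (cases "M = M0")
    case True
    then show ?thesis using F by blast
  next
    case False
    then have "\<exists>v. v \<in> M \<and> v n \<noteq> 0" by (auto simp: M0_def)
    then obtain m where m: "m \<in> M" "m n \<noteq> 0"
      and least: "\<And>v. v \<in> M \<Longrightarrow> v n \<noteq> 0 \<Longrightarrow> nat \<bar>m n\<bar> \<le> nat \<bar>v n\<bar>"
      using ex_has_least_nat[of "\<lambda>v. v \<in> M \<and> v n \<noteq> 0" _ "\<lambda>v. nat \<bar>v n\<bar>"] by blast
    have "v \<in> int_vec.span (insert m F)" if "v \<in> M" for v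
    proof -
      \<comment> \<open>Division with remainder by \<open>m n\<close>: by minimality, the last coordinate of \<open>r\<close> must vanish.\<close>
      define r where "r = v - (\<lambda>i. (v n div m n) * m i)"
      have "r \<in> M"
        unfolding r_def using M_sub m(1) that
        by (intro int_vec.subspace_diff int_vec.subspace_scale)
      moreover have "r n = v n mod m n"
        by (simp add: r_def minus_div_mult_eq_mod)
      moreover have "\<bar>v n mod m n\<bar> < \<bar>m n\<bar>"
        using m(2) by (rule abs_mod_less)
      ultimately have "r \<in> M0"
        using least[of r] by (force simp: M0_def)
      then show ?thesis
        using F(3) unfolding r_def int_vec.span_breakdown_eq by blast
    qed
    then show ?thesis
      using F m(1) by (intro exI[of _ "insert m F"]) (auto simp: M0_def)
  qed
  then obtain B where B: "B \<subseteq> M" "finite B" "M \<subseteq> int_vec.span B" by blast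
  then obtain F' where F': "F' \<subseteq> A" "finite F'" "B \<subseteq> int_vec.span F'"
    using int_vec.finite_subset_of_span[OF B(2) B(1)[unfolded M_def]] by blast
  have "A \<subseteq> M"
    by (simp add: M_def int_vec.span_superset)
  also have "M \<subseteq> int_vec.span F'"
    using B(3) int_vec.span_minimal[OF F'(3) int_vec.subspace_span] by blast
  finally show ?case
    using F' by blast
qed

section \<open>Equations over abelian groups\<close>

text \<open>
  The inverse is written as multiplication by \<open>-1\<close> so that it is an instance of the scalar
  multiplication of the module of integer vectors.
\<close>

primrec exponents :: "('c, nat) grp_term \<Rightarrow> nat \<Rightarrow> int" where
  "exponents (Var x) = (\<lambda>i. if x = i then 1 else 0)"
| "exponents (Const c) = (\<lambda>_. 0)"
| "exponents One = (\<lambda>_. 0)"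
| "exponents (Inv t) = (\<lambda>i. (-1) * exponents t i)"
| "exponents (Mult s t) = exponents s + exponents t"

lemma exponents_eq_0: "i \<notin> term_vars t \<Longrightarrow> exponents t i = 0"
  by (induction t) auto

definition monomial :: "('a, 'b) monoid_scheme \<Rightarrow> nat \<Rightarrow> (nat \<Rightarrow> 'a) \<Rightarrow> (nat \<Rightarrow> int) \<Rightarrow> 'a" where
  "monomial G n \<sigma> v = finprod G (\<lambda>i. \<sigma> i [^]\<^bsub>G\<^esub> v i) {..<n}"

context comm_group
begin

lemma monomial_closed:
  "\<sigma> \<in> {..<n} \<rightarrow> carrier G \<Longrightarrow> monomial G n \<sigma> v \<in> carrier G"
  unfolding monomial_def by (intro finprod_closed) auto

lemma monomial_0: "monomial G n \<sigma> (\<lambda>_. 0) = \<one>"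
  by (simp add: monomial_def)

lemma monomial_add:
  assumes "\<sigma> \<in> {..<n} \<rightarrow> carrier G"
  shows "monomial G n \<sigma> (v + w) = monomial G n \<sigma> v \<otimes> monomial G n \<sigma> w"
proof -
  have "monomial G n \<sigma> (v + w) = finprod G (\<lambda>i. \<sigma> i [^] v i \<otimes> \<sigma> i [^] w i) {..<n}"
    unfolding monomial_def using assms by (intro finprod_cong') (auto simp: int_pow_mult Pi_iff)
  then show ?thesis
    using assms unfolding monomial_def by (subst (asm) finprod_multf) auto
qed

lemma monomial_scale:
  assumes "\<sigma> \<in> {..<n} \<rightarrow> carrier G"
  shows "monomial G n \<sigma> (\<lambda>i. c * v i) = monomial G n \<sigma> v [^] c"
  using assms
proof (induction n)
  case 0
  then show ?case by (simp add: monomial_def)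
next
  case (Suc n)
  then have "\<sigma> \<in> {..<n} \<rightarrow> carrier G" "\<sigma> n \<in> carrier G" by auto
  then show ?case
    using Suc.IH monomial_closed[of \<sigma> n v]
    by (simp add: monomial_def lessThan_Suc finprod_insert Pi_iff int_pow_distrib int_pow_pow
        mult.commute)
qed

lemma monomial_unit:
  assumes "\<sigma> \<in> {..<n} \<rightarrow> carrier G" "x < n"
  shows "monomial G n \<sigma> (\<lambda>i. if x = i then 1 else 0) = \<sigma> x"
proof -
  have "monomial G n \<sigma> (\<lambda>i. if x = i then 1 else 0) =
      finprod G (\<lambda>i. if x = i then \<sigma> i else \<one>) {..<n}"
    unfolding monomial_def using assms by (intro finprod_cong') (auto simp: int_pow_1 Pi_iff)
  then show ?thesis
    using assms by (simp add: finprod_singleton)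
qed

text \<open>
  In an abelian group, the constants and the variables of a term can be collected separately.
  Substituting \<open>\<one>\<close> for all variables leaves the product of the constants.
\<close>

lemma eval_term_eq_monomial:
  assumes "\<sigma> \<in> {..<n} \<rightarrow> carrier G" "term_consts t \<subseteq> carrier G" "term_vars t \<subseteq> {..<n}"
  shows "eval_term G \<sigma> t = eval_term G (\<lambda>_. \<one>) t \<otimes> monomial G n \<sigma> (exponents t)"
  using assms(2,3)
proof (induction t)
  case (Var x)
  then show ?case using assms(1) by (auto simp: monomial_unit Pi_iff)
next
  case (Inv t)
  then have "eval_term G (\<lambda>_. \<one>) t \<in> carrier G"
    by (intro eval_term_closed) auto
  then show ?case
    using Inv assms(1) monomial_closed[OF assms(1)] monomial_scale[OF assms(1), of "-1"]
    by (simp add: int_pow_neg int_pow_1 inv_mult)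
next
  case (Mult s t)
  then have "eval_term G (\<lambda>_. \<one>) s \<in> carrier G" "eval_term G (\<lambda>_. \<one>) t \<in> carrier G"
    by (auto intro!: eval_term_closed)
  then show ?case
    using Mult assms(1) monomial_closed[OF assms(1)] by (simp add: monomial_add[unfolded plus_fun_def] m_ac plus_fun_def)
qed (auto simp: monomial_0)

text \<open>
  An equation prescribes the value of one monomial; the right-hand side does not depend on \<open>\<sigma>\<close>.
\<close>

lemma equation_iff_monomial:
  assumes \<sigma>: "\<sigma> \<in> {..<n} \<rightarrow> carrier G"
    and "term_consts p \<union> term_consts q \<subseteq> carrier G" "term_vars p \<union> term_vars q \<subseteq> {..<n}"
  shows "eval_term G \<sigma> p = eval_term G \<sigma> q \<longleftrightarrow>
    monomial G n \<sigma> (exponents p - exponents q) =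
      inv (eval_term G (\<lambda>_. \<one>) p) \<otimes> eval_term G (\<lambda>_. \<one>) q"
proof -
  define P Q D where "P = eval_term G (\<lambda>_. \<one>) p" and "Q = eval_term G (\<lambda>_. \<one>) q"
    and "D = monomial G n \<sigma> (exponents p - exponents q)"
  have PQ: "P \<in> carrier G" "Q \<in> carrier G"
    unfolding P_def Q_def using assms by (auto intro!: eval_term_closed)
  define E where "E = monomial G n \<sigma> (exponents q)"
  have DE: "D \<in> carrier G" "E \<in> carrier G"
    unfolding D_def E_def using \<sigma> by (simp_all add: monomial_closed)
  have "monomial G n \<sigma> (exponents p) = D \<otimes> E"
    using monomial_add[OF \<sigma>, of "exponents p - exponents q" "exponents q"]
    by (simp add: D_def E_def)
  then have "eval_term G \<sigma> p = eval_term G \<sigma> q \<longleftrightarrow> P \<otimes> (D \<otimes> E) = Q \<otimes> E"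
    using assms eval_term_eq_monomial[OF \<sigma>] by (simp add: P_def Q_def E_def)
  also have "\<dots> \<longleftrightarrow> P \<otimes> D = Q"
    using PQ DE by (simp flip: m_assoc)
  also have "\<dots> \<longleftrightarrow> D = inv P \<otimes> Q"
    using PQ DE by (metis inv_solve_left)
  finally show ?thesis
    by (simp add: D_def P_def Q_def)
qed

text \<open>
  The subsystem \<open>S0\<close> consists of equations whose exponent vectors span all exponent vectors of \<open>S\<close>. The
  vectors \<open>v\<close> whose monomial takes the same value at two given assignments form a submodule; for two
  solutions of \<open>S0\<close> it contains the exponent vectors of \<open>S0\<close>, hence those of \<open>S\<close> (step \<open>transfer\<close>).
  Thus each equation of \<open>S\<close> holds at all solutions of \<open>S0\<close> or at none. If some equation \<open>e\<close> fails at a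
  solution of \<open>S0\<close>, then adding \<open>e\<close> to \<open>S0\<close> leaves no solution, and \<open>S\<close> has none either.
\<close>

lemma abelian_imp_equationally_noetherian: "equationally_noetherian G"
  unfolding equationally_noetherian_def
proof (intro allI impI, elim conjE)
  fix n S
  assume S: "eqn_system G n S"
  define expo :: "('a, nat) grp_eqn \<Rightarrow> nat \<Rightarrow> int" where
    "expo e = exponents (fst e) - exponents (snd e)" for e
  define holds where "holds \<sigma> e \<longleftrightarrow> eval_term G \<sigma> (fst e) = eval_term G \<sigma> (snd e)"
    for \<sigma> and e :: "('a, nat) grp_eqn"
  have sol: "solution_set G n T = {\<sigma> \<in> {..<n} \<rightarrow>\<^sub>E carrier G. \<forall>e \<in> T. holds \<sigma> e}" for T
    by (auto simp: solution_set_def holds_def)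
  have wf: "term_consts (fst e) \<union> term_consts (snd e) \<subseteq> carrier G"
    "term_vars (fst e) \<union> term_vars (snd e) \<subseteq> {..<n}" if "e \<in> S" for e
    using bspec[OF S[unfolded eqn_system_def] that] by (simp_all add: case_prod_beta)
  have holds_iff: "holds \<sigma> e \<longleftrightarrow> monomial G n \<sigma> (expo e) =
      inv (eval_term G (\<lambda>_. \<one>) (fst e)) \<otimes> eval_term G (\<lambda>_. \<one>) (snd e)"
    if "\<sigma> \<in> {..<n} \<rightarrow>\<^sub>E carrier G" "e \<in> S" for \<sigma> e
    unfolding holds_def expo_def using that wf[of e]
    by (intro equation_iff_monomial) (auto simp: PiE_iff)
  have "v i = 0" if v: "v \<in> expo ` S" "n \<le> i" for v :: "nat \<Rightarrow> int" and i
  proof -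
    obtain e where "e \<in> S" "v = expo e" using v(1) by blast
    moreover have "i \<notin> term_vars (fst e)" "i \<notin> term_vars (snd e)"
      using wf(2)[OF \<open>e \<in> S\<close>] v(2) by auto
    ultimately show ?thesis by (simp add: expo_def exponents_eq_0)
  qed
  with finite_subset_spanning[of "expo ` S" n] obtain F where
    F: "F \<subseteq> expo ` S" "finite F" "expo ` S \<subseteq> int_vec.span F" by blast
  obtain S0 where S0: "S0 \<subseteq> S" "finite S0" "F = expo ` S0"
    using finite_subset_image[OF F(2,1)] by blast
  have transfer: "holds \<sigma> e \<longleftrightarrow> holds \<tau> e"
    if \<sigma>: "\<sigma> \<in> solution_set G n S0" and \<tau>: "\<tau> \<in> solution_set G n S0" and e: "e \<in> S" for \<sigma> \<tau> e
  proof -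
    have \<sigma>\<tau>: "\<sigma> \<in> {..<n} \<rightarrow>\<^sub>E carrier G" "\<tau> \<in> {..<n} \<rightarrow>\<^sub>E carrier G"
      using \<sigma> \<tau> by (auto simp: sol)
    then have \<sigma>\<tau>': "\<sigma> \<in> {..<n} \<rightarrow> carrier G" "\<tau> \<in> {..<n} \<rightarrow> carrier G"
      by auto
    let ?E = "{v. monomial G n \<sigma> v = monomial G n \<tau> v}"
    have "int_vec.subspace ?E"
      by (rule int_vec.subspaceI)
        (use \<sigma>\<tau>' in \<open>auto simp: monomial_add monomial_scale monomial_0 zero_fun_def\<close>)
    moreover have "expo d \<in> ?E" if "d \<in> S0" for d
    proof -
      have "d \<in> S" "holds \<sigma> d" "holds \<tau> d"
        using \<sigma> \<tau> S0(1) that by (auto simp: sol)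
      then show ?thesis
        using holds_iff[OF \<sigma>\<tau>(1)] holds_iff[OF \<sigma>\<tau>(2)] by simp
    qed
    then have "F \<subseteq> ?E"
      using S0(3) by blast
    ultimately have "int_vec.span F \<subseteq> ?E"
      by (intro int_vec.span_minimal)
    then have "expo e \<in> ?E"
      using F(3) e by (meson imageI subsetD)
    then show ?thesis
      using holds_iff[OF \<sigma>\<tau>(1) e] holds_iff[OF \<sigma>\<tau>(2) e] by simp
  qed
  show "\<exists>S' \<subseteq> S. finite S' \<and> solution_set G n S' = solution_set G n S"
  proof (cases "solution_set G n S0 \<subseteq> solution_set G n S")
    case True
    then have "solution_set G n S0 = solution_set G n S"
      using S0(1) by (auto simp: sol)
    then show ?thesis using S0 by blast
  next
    case False
    then obtain \<sigma> e where \<sigma>: "\<sigma> \<in> solution_set G n S0" "e \<in> S" "\<not> holds \<sigma> e"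
      by (auto simp: sol)
    have "solution_set G n (insert e S0) = {}"
      using transfer[OF _ \<sigma>(1,2)] \<sigma>(3) by (auto simp: sol)
    moreover have "solution_set G n S \<subseteq> solution_set G n (insert e S0)"
      using S0(1) \<sigma>(2) by (auto simp: sol)
    ultimately have "solution_set G n (insert e S0) = solution_set G n S"
      by simp
    then show ?thesis
      using S0 \<sigma>(2) by (intro exI[of _ "insert e S0"]) auto
  qed
qed

end

section \<open>Varieties of equationally Noetherian groups\<close>

lemma noetherian_variety_imp_abelian:
  fixes V :: "'a monoid set"
  assumes "infinite (UNIV :: 'a set)" "group_variety V"
    and noeth: "\<And>G. G \<in> V \<Longrightarrow> equationally_noetherian G"
    and "H \<in> V"
  shows "comm_group H"
proof (rule ccontr)
  assume nonabelian: "\<not> comm_group H"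
  obtain I :: "('a, nat) grp_eqn set" where
    I: "\<forall>(p, q) \<in> I. term_consts p = {} \<and> term_consts q = {}"
    and V: "V = {G. group G \<and> (\<forall>e \<in> I. satisfies_identity G e)}"
    using assms(2) unfolding group_variety_def by (elim exE conjE)
  have H: "group H" "\<And>e. e \<in> I \<Longrightarrow> satisfies_identity H e"
    using assms(4) V by auto
  show False
  proof (rule exists_subdirect_power_with_dual_commutation[OF H(1) nonabelian assms(1)])
    fix G :: "'a monoid" and h :: "nat \<Rightarrow> 'a \<Rightarrow> 'a" and \<alpha> \<beta> :: "nat \<Rightarrow> 'a"
    assume G: "group G" "\<And>i. h i \<in> hom G H"
        "\<And>x y. x \<in> carrier G \<Longrightarrow> y \<in> carrier G \<Longrightarrow> (\<And>i. h i x = h i y) \<Longrightarrow> x = y"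
      and \<alpha>\<beta>: "\<And>i. \<alpha> i \<in> carrier G" "\<And>i. \<beta> i \<in> carrier G"
        "\<And>i j. \<alpha> i \<otimes>\<^bsub>G\<^esub> \<beta> j = \<beta> j \<otimes>\<^bsub>G\<^esub> \<alpha> i \<longleftrightarrow> i \<noteq> j"
    have "satisfies_identity G e" if "e \<in> I" for e
      using bspec[OF I that] that
      by (intro satisfies_identity_subdirect_power[OF G(1) H(1) G(2,3) _ _ H(2)])
        (simp_all add: case_prod_beta)
    then have "G \<in> V"
      using G(1) V by simp
    then show False
      using noeth not_equationally_noetherian_if_dual_commutation[of \<alpha> G \<beta>] \<alpha>\<beta> by simp
  qed
qed

theorem theorem4p1:
  fixes V :: "'a monoid set"
  assumes "infinite (UNIV :: 'a set)"
    and "group_variety V"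
  shows "(\<forall>G \<in> V. equationally_noetherian G) \<longleftrightarrow> (\<forall>G \<in> V. comm_group G)"
  using noetherian_variety_imp_abelian[OF assms] comm_group.abelian_imp_equationally_noetherian
  by blast

end
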